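(* Let $\mu_0\le\mu_1$ be real numbers, $\sigma>0$, $\tilde p\in(0,1)$, $D\ge 0$, $\alpha>1$, and let $C$, $X$, $Z$ (with additive noise) and the Sibson mutual information $I_\alpha(C;Z)$ be as defined in the context. Let $$\mathcal G=\{(\beta_0,\beta_1,\gamma)\in\mathbb R^3:\ \beta_0,\beta_1,\gamma\ge0,\ (1-\tilde p)\beta_0^2+\tilde p\beta_1^2+\gamma^2\le D,\ \mu_0+\beta_0\le\mu_1-\beta_1\}.$$ Then the optimal parameters $(\beta_0^*,\beta_1^*,\gamma^* )$ minimizing $I_\alpha(C;Z)$ over $\mathcal G$ are exactly the solutions of $$\min_{(\beta_0,\beta_1,\gamma)\in\mathcal G}\ \frac{(\mu_1-\beta_1)-(\mu_0+\beta_0)}{\sqrt{\sigma^2+\gamma^2}}.$$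
   Context: $C\in\{0,1\}$ is a private label with $P(C=0)=\tilde p$, $P(C=1)=1-\tilde p$. Given $C=0$, $X\sim\mathcal N(\mu_0,\sigma^2)$; given $C=1$, $X\sim\mathcal N(\mu_1,\sigma^2)$. For parameters $\beta_0,\beta_1,\gamma\ge 0$ the disclosed variable is $Z=X+(1-C)\beta_0-C\beta_1+\gamma N$, where $N\sim\mathcal N(0,1)$ is independent of $(X,C)$; hence $Z\mid C=0\sim\mathcal N(\mu_0+\beta_0,\sigma^2+\gamma^2)$ and $Z\mid C=1\sim\mathcal N(\mu_1-\beta_1,\sigma^2+\gamma^2)$. The Sibson mutual information of order $\alpha$ is $I_\alpha(C;Z)=\frac{\alpha}{\alpha-1}\log\int_{\mathbb R}\big(\tilde p\,p_{Z|C=0}(z)^\alpha+(1-\tilde p)\,p_{Z|C=1}(z)^\alpha\big)^{1/\alpha}dz$, where $p_{Z|C=c}$ is the conditional density of $Z$ given $C=c$. *)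

theory Defs
  imports "HOL-Probability.Probability"
begin

definition label_event :: "'a measure \<Rightarrow> ('a \<Rightarrow> nat) \<Rightarrow> nat \<Rightarrow> 'a set" where
  "label_event M C c = {\<omega> \<in> space M. C \<omega> = c}"

(* uniform_measure M A is the conditional probability M(. | A), for any A with 0 < M(A) *)
definition cond_given_label :: "'a measure \<Rightarrow> ('a \<Rightarrow> nat) \<Rightarrow> nat \<Rightarrow> 'a measure" where
  "cond_given_label M C c = uniform_measure M (label_event M C c)"

(* Lebesgue density of the conditional law of Z given C = c; it is determined only up to
   null sets, which does not affect the integral in sibson_mi *)
definition cond_density ::
    "'a measure \<Rightarrow> ('a \<Rightarrow> nat) \<Rightarrow> ('a \<Rightarrow> real) \<Rightarrow> nat \<Rightarrow> real \<Rightarrow> real" where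
  "cond_density M C Z c z =
     enn2real (RN_deriv lborel (distr (cond_given_label M C c) lborel Z) z)"

definition sibson_mi ::
    "real \<Rightarrow> 'a measure \<Rightarrow> ('a \<Rightarrow> nat) \<Rightarrow> ('a \<Rightarrow> real) \<Rightarrow> real" where
  "sibson_mi \<alpha> M C Z =
     \<alpha> / (\<alpha> - 1) *
     ln (LINT z|lborel.
          (measure M (label_event M C 0) * cond_density M C Z 0 z powr \<alpha> +
           measure M (label_event M C 1) * cond_density M C Z 1 z powr \<alpha>) powr (1 / \<alpha>))"

definition disclosed ::
    "('a \<Rightarrow> nat) \<Rightarrow> ('a \<Rightarrow> real) \<Rightarrow> ('a \<Rightarrow> real) \<Rightarrow> real \<Rightarrow> real \<Rightarrow> real \<Rightarrow> 'a \<Rightarrow> real" where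
  "disclosed C X N \<beta>\<^sub>0 \<beta>\<^sub>1 \<gamma> \<omega> =
     X \<omega> + (1 - real (C \<omega>)) * \<beta>\<^sub>0 - real (C \<omega>) * \<beta>\<^sub>1 + \<gamma> * N \<omega>"

definition feasible :: "real \<Rightarrow> real \<Rightarrow> real \<Rightarrow> real \<Rightarrow> (real \<times> real \<times> real) set" where
  "feasible \<mu>\<^sub>0 \<mu>\<^sub>1 p D =
     {(\<beta>\<^sub>0, \<beta>\<^sub>1, \<gamma>). \<beta>\<^sub>0 \<ge> 0 \<and> \<beta>\<^sub>1 \<ge> 0 \<and> \<gamma> \<ge> 0 \<and>
        (1 - p) * \<beta>\<^sub>0\<^sup>2 + p * \<beta>\<^sub>1\<^sup>2 + \<gamma>\<^sup>2 \<le> D \<and> \<mu>\<^sub>0 + \<beta>\<^sub>0 \<le> \<mu>\<^sub>1 - \<beta>\<^sub>1}"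

end

(* With d the separation of the two conditional means in units of the standard deviation of Z,
   the integral in sibson_mi rescales to G d = E (p + (1 - p) * L_d powr \<alpha>) powr (1 / \<alpha>), where
   L_d = exp (d * z - d^2 / 2) is the likelihood ratio of N(d, 1) and N(0, 1) and the expectation
   is under N(0, 1). The function of L_d is strictly convex, L_s and L_t have the same mean, and
   for 0 <= s < t they cross exactly once, so G is strictly increasing. Hence sibson_mi is a
   strictly increasing function of d on the feasible set. *)
theory Submission
  imports Defs
begin

section \<open>Weighted power means: homogeneity, bounds and strict convexity in the second
  argument\<close>

definition power_mean :: "real \<Rightarrow> real \<Rightarrow> real \<Rightarrow> real \<Rightarrow> real" where
  "power_mean \<alpha> p x y = (p * x powr \<alpha> + (1 - p) * y powr \<alpha>) powr (1 / \<alpha>)"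

lemma power_mean_scale:
  assumes "\<alpha> > 0" "0 \<le> p" "p \<le> 1" "c > 0" "0 \<le> x" "0 \<le> y"
  shows "power_mean \<alpha> p (c * x) (c * y) = c * power_mean \<alpha> p x y"
proof -
  have "p * (c * x) powr \<alpha> + (1 - p) * (c * y) powr \<alpha>
      = c powr \<alpha> * (p * x powr \<alpha> + (1 - p) * y powr \<alpha>)"
    using assms by (simp add: powr_mult algebra_simps)
  then show ?thesis
    using assms by (simp add: power_mean_def powr_mult powr_powr)
qed

lemma power_mean_same:
  assumes "\<alpha> > 0" "0 \<le> x"
  shows "power_mean \<alpha> p x x = x"
  using assms by (simp add: power_mean_def powr_powr flip: distrib_right)

text \<open>Both arguments are at most \<open>x + y\<close>, and the mean is monotone. This crude
  bound makes the mean of two integrable densities integrable.\<close>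

lemma power_mean_le_add:
  assumes "\<alpha> > 0" "0 \<le> p" "p \<le> 1" "0 \<le> x" "0 \<le> y"
  shows "power_mean \<alpha> p x y \<le> x + y"
proof -
  have "p * x powr \<alpha> + (1 - p) * y powr \<alpha> \<le> p * (x + y) powr \<alpha> + (1 - p) * (x + y) powr \<alpha>"
    using assms by (intro add_mono mult_left_mono powr_mono2) auto
  then have "power_mean \<alpha> p x y \<le> power_mean \<alpha> p (x + y) (x + y)"
    unfolding power_mean_def using assms by (intro powr_mono2) auto
  then show ?thesis using assms by (simp add: power_mean_same)
qed

lemma power_mean_nonneg: "power_mean \<alpha> p x y \<ge> 0"
  by (simp add: power_mean_def)

lemma borel_measurable_power_mean [measurable]:
  assumes [measurable]: "f \<in> borel_measurable M" "g \<in> borel_measurable M"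
  shows "(\<lambda>z. power_mean \<alpha> p (f z) (g z)) \<in> borel_measurable M"
  unfolding power_mean_def by measurable

text \<open>The derivative of \<open>power_mean \<alpha> p 1\<close>, with a power of
  \<open>y\<close> absorbed so that \<open>y\<close> occurs only once; monotonicity can then be read
  off.\<close>

definition power_mean_slope :: "real \<Rightarrow> real \<Rightarrow> real \<Rightarrow> real" where
  "power_mean_slope \<alpha> p y = (1 - p) * (p * y powr (- \<alpha>) + (1 - p)) powr (1 / \<alpha> - 1)"

lemma power_mean_has_real_derivative:
  assumes "\<alpha> > 0" "0 < p" "p < 1" "y > 0"
  shows "(power_mean \<alpha> p 1 has_real_derivative power_mean_slope \<alpha> p y) (at y)"
proof -
  let ?B = "p + (1 - p) * y powr \<alpha>"
  have B: "?B > 0" using assms by (simp add: add_pos_pos)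
  \<comment> \<open>The chain rule produces
    \<open>y powr (\<alpha> - 1) * ?B powr (1 / \<alpha> - 1)\<close>. Pulling
    \<open>y powr (- \<alpha>)\<close> out of the base turns this into the form of
    \<open>power_mean_slope\<close>.\<close>
  have eq: "p * y powr (- \<alpha>) + (1 - p) = y powr (- \<alpha>) * ?B"
    using assms by (simp add: algebra_simps flip: powr_add)
  have "- \<alpha> * (1 / \<alpha> - 1) = \<alpha> - 1" using assms by (simp add: field_simps)
  then have "(p * y powr (- \<alpha>) + (1 - p)) powr (1 / \<alpha> - 1) = y powr (\<alpha> - 1) * ?B powr (1 / \<alpha> - 1)"
    unfolding eq by (subst powr_mult) (simp only: powr_powr)
  then have s: "power_mean_slope \<alpha> p y = (1 - p) * (y powr (\<alpha> - 1) * ?B powr (1 / \<alpha> - 1))"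
    by (simp add: power_mean_slope_def)
  have "((\<lambda>y. p + (1 - p) * y powr \<alpha>) has_real_derivative 0 + (1 - p) * (\<alpha> * y powr (\<alpha> - 1))) (at y)"
    using assms by (intro DERIV_add DERIV_const DERIV_cmult has_real_derivative_powr) auto
  from DERIV_fun_powr[OF this B, of "1 / \<alpha>"]
  have "((\<lambda>y. (p + (1 - p) * y powr \<alpha>) powr (1 / \<alpha>)) has_real_derivative power_mean_slope \<alpha> p y) (at y)"
    by (rule DERIV_cong) (use assms s in simp)
  then show ?thesis
    by (simp add: power_mean_def[abs_def])
qed

text \<open>For \<alpha> > 1 both exponents, \<open>- \<alpha>\<close> and
  \<open>1 / \<alpha> - 1\<close>, are negative, so two decreasing maps are composed. This is the
  strict convexity of \<open>power_mean \<alpha> p 1\<close>.\<close>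

lemma power_mean_slope_strict_mono:
  assumes "\<alpha> > 1" "0 < p" "p < 1" "0 < x" "x < y"
  shows "power_mean_slope \<alpha> p x < power_mean_slope \<alpha> p y"
proof -
  have "y powr (- \<alpha>) < x powr (- \<alpha>)"
    using assms by (intro powr_less_mono2_neg) auto
  then show ?thesis
    unfolding power_mean_slope_def using assms
    by (intro mult_strict_left_mono powr_less_mono2_neg) (auto intro!: add_pos_pos)
qed

text \<open>By the mean value theorem the chord from \<open>x\<close> to \<open>y\<close> has the
  slope at some \<xi> strictly between them. Moving from \<open>x\<close> to \<open>y\<close> leads
  away from \<open>k\<close>, so this slope exceeds the one at \<open>k\<close> when
  \<open>y - x\<close> is positive and falls below it when \<open>y - x\<close> is negative.\<close>

lemma power_mean_tangent_less:
  assumes "\<alpha> > 1" "0 < p" "p < 1" "0 < x" "0 < y" "0 < k"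
    and "k \<le> x \<and> x < y \<or> y < x \<and> x \<le> k"
  shows "power_mean_slope \<alpha> p k * (y - x) < power_mean \<alpha> p 1 y - power_mean \<alpha> p 1 x"
  using assms(7)
proof
  assume h: "k \<le> x \<and> x < y"
  then obtain \<xi> where \<xi>: "x < \<xi>" "\<xi> < y"
    "power_mean \<alpha> p 1 y - power_mean \<alpha> p 1 x = (y - x) * power_mean_slope \<alpha> p \<xi>"
    using MVT2[of x y "power_mean \<alpha> p 1" "power_mean_slope \<alpha> p"]
      power_mean_has_real_derivative[of \<alpha> p] assms by auto
  then show ?thesis
    using power_mean_slope_strict_mono[of \<alpha> p k \<xi>] assms h by simp
next
  assume h: "y < x \<and> x \<le> k"
  then obtain \<xi> where \<xi>: "y < \<xi>" "\<xi> < x"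
    "power_mean \<alpha> p 1 x - power_mean \<alpha> p 1 y = (x - y) * power_mean_slope \<alpha> p \<xi>"
    using MVT2[of y x "power_mean \<alpha> p 1" "power_mean_slope \<alpha> p"]
      power_mean_has_real_derivative[of \<alpha> p] assms by auto
  have "(x - y) * power_mean_slope \<alpha> p \<xi> < (x - y) * power_mean_slope \<alpha> p k"
    using power_mean_slope_strict_mono[of \<alpha> p \<xi> k] assms h \<xi> by simp
  then show ?thesis
    using \<xi>(3) by (simp add: algebra_simps)
qed

section \<open>The integral for two unit-variance normal densities as a function of their
  separation\<close>

definition gaussian_power_mean :: "real \<Rightarrow> real \<Rightarrow> real \<Rightarrow> real" where
  "gaussian_power_mean \<alpha> p d =
     (LINT z|lborel. power_mean \<alpha> p (normal_density 0 1 z) (normal_density d 1 z))"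

lemma integrable_power_mean:
  assumes "\<alpha> > 0" "0 \<le> p" "p \<le> 1"
    and f: "integrable M f" "\<And>z. 0 \<le> f z" and g: "integrable M g" "\<And>z. 0 \<le> g z"
  shows "integrable M (\<lambda>z. power_mean \<alpha> p (f z) (g z))"
proof (rule Bochner_Integration.integrable_bound)
  show "integrable M (\<lambda>z. f z + g z)" using f g by simp
  show "(\<lambda>z. power_mean \<alpha> p (f z) (g z)) \<in> borel_measurable M"
    using f g by measurable
  show "AE z in M. norm (power_mean \<alpha> p (f z) (g z)) \<le> norm (f z + g z)"
    using assms power_mean_le_add[of \<alpha> p] power_mean_nonneg[of \<alpha> p] by (intro AE_I2) auto
qed

lemma normal_density_shift_eq:
  "normal_density d 1 z = normal_density 0 1 z * exp (d * z - d\<^sup>2 / 2)"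
  by (simp add: normal_density_def power2_eq_square field_simps flip: exp_add)

text \<open>Subtracting \<open>c\<close> times the mean-zero difference of the two densities, with \<open>c\<close> the slope at the
  crossing point \<open>w\<close>, makes the difference of the integrands positive pointwise off \<open>w\<close>.\<close>

lemma gaussian_power_mean_strict_mono:
  assumes a: "\<alpha> > 1" "0 < p" "p < 1" and st: "0 \<le> s" "s < t"
  shows "gaussian_power_mean \<alpha> p s < gaussian_power_mean \<alpha> p t"
proof -
  define L where "L d z = exp (d * z - d\<^sup>2 / 2)" for d z :: real
  \<comment> \<open>The point where the two likelihood ratios agree:
    \<open>s * z - s\<^sup>2 / 2 = t * z - t\<^sup>2 / 2\<close> holds only there.\<close>
  define w where "w = (s + t) / 2"
  define c where "c = power_mean_slope \<alpha> p (L s w)"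
  let ?\<phi> = "normal_density 0 1"
  define F where "F d z = power_mean \<alpha> p (?\<phi> z) (normal_density d 1 z)" for d z
  define H where "H z = (F t z - F s z) - c * (normal_density t 1 z - normal_density s 1 z)" for z
  have F: "F d z = ?\<phi> z * power_mean \<alpha> p 1 (L d z)" for d z
    using power_mean_scale[of \<alpha> p "?\<phi> z" 1 "L d z"] a
    by (simp add: F_def L_def normal_density_shift_eq[of d] normal_density_pos)
  have H: "H z = ?\<phi> z * (power_mean \<alpha> p 1 (L t z) - power_mean \<alpha> p 1 (L s z) - c * (L t z - L s z))" for z
    by (simp add: H_def F normal_density_shift_eq[of s] normal_density_shift_eq[of t] L_def algebra_simps)
  have exponent: "(t * z - t\<^sup>2 / 2) - (s * z - s\<^sup>2 / 2) = (t - s) * (z - w)" for z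
    by (simp add: w_def power2_eq_square field_simps)
  have H_pos: "H z > 0" if "z \<noteq> w" for z
  proof -
    \<comment> \<open>Right of \<open>w\<close> the ratio \<open>L t\<close> is the larger one and
      left of it the smaller one, while \<open>0 \<le> s\<close> makes \<open>L s\<close>
      nondecreasing. These are the two cases of \<open>power_mean_tangent_less\<close> with
      \<open>k = L s w\<close>.\<close>
    have "L s w \<le> L s z \<and> L s z < L t z \<or> L t z < L s z \<and> L s z \<le> L s w"
    proof (cases "w < z")
      case True
      then have "(t - s) * (z - w) > 0" using st by simp
      then have "s * z - s\<^sup>2 / 2 < t * z - t\<^sup>2 / 2" using exponent[of z] by linarith
      moreover have "s * w \<le> s * z" using True st by (intro mult_left_mono) auto
      ultimately show ?thesis by (simp add: L_def)
    next
      case False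
      then have "(t - s) * (z - w) < 0" using st that by (simp add: mult_less_0_iff)
      then have "t * z - t\<^sup>2 / 2 < s * z - s\<^sup>2 / 2" using exponent[of z] by linarith
      moreover have "s * z \<le> s * w" using False st by (intro mult_left_mono) auto
      ultimately show ?thesis by (simp add: L_def)
    qed
    then have "c * (L t z - L s z) < power_mean \<alpha> p 1 (L t z) - power_mean \<alpha> p 1 (L s z)"
      unfolding c_def using a by (intro power_mean_tangent_less) (auto simp: L_def)
    then show ?thesis unfolding H by (simp add: normal_density_pos)
  qed
  have H_w: "H w = 0"
    using exponent[of w] by (simp add: H L_def)
  have H_nonneg: "0 \<le> H z" for z
    using H_pos[of z] H_w by (cases "z = w") auto
  have int_F: "integrable lborel (F d)" for d
    unfolding F_def using a by (intro integrable_power_mean) (auto simp: normal_density_nonneg)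
  have int_H: "integrable lborel H"
    unfolding H_def using int_F by simp
  have "integral\<^sup>L lborel H = integral\<^sup>L lborel (F t) - integral\<^sup>L lborel (F s)"
    unfolding H_def using int_F by simp
  \<comment> \<open>A nonnegative function with zero integral vanishes almost everywhere, but
    \<open>H\<close> vanishes only at \<open>w\<close>, which is a null set.\<close>
  moreover have "integral\<^sup>L lborel H \<noteq> 0"
  proof
    assume "integral\<^sup>L lborel H = 0"
    then have "AE z in lborel. H z = 0"
      using integral_nonneg_eq_0_iff_AE[OF int_H] H_nonneg by simp
    moreover have "AE z in lborel. z \<noteq> w" by (rule AE_lborel_singleton)
    ultimately have "AE z in (lborel :: real measure). False"
      by eventually_elim (use H_pos in fastforce)
    then show False by (simp add: eventually_False ae_filter_eq_bot_iff)
  qed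
  moreover have "integral\<^sup>L lborel H \<ge> 0"
    using H_nonneg by (intro integral_nonneg_AE) simp
  ultimately show ?thesis
    by (simp add: gaussian_power_mean_def F_def[abs_def])
qed

text \<open>At separation 0 the two densities coincide and the integral is 1; monotonicity does the
  rest. Positivity is what permits comparing logarithms later.\<close>

lemma gaussian_power_mean_pos:
  assumes "\<alpha> > 1" "0 < p" "p < 1" "0 \<le> d"
  shows "gaussian_power_mean \<alpha> p d > 0"
proof -
  have "gaussian_power_mean \<alpha> p 0 = 1"
    using assms by (simp add: gaussian_power_mean_def power_mean_same normal_density_nonneg)
  then show ?thesis
    using gaussian_power_mean_strict_mono[of \<alpha> p 0 d] assms by (cases "d = 0") auto
qed

text \<open>Substituting \<open>m + s * z\<close> turns both densities into \<open>1 / s\<close>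
  times unit-variance ones. Homogeneity pulls this factor out, and it cancels against the Jacobian
  \<open>s\<close>.\<close>

lemma integral_power_mean_normal_density:
  assumes a: "\<alpha> > 1" "0 < p" "p < 1" and s: "s > 0"
  shows "(LINT z|lborel. power_mean \<alpha> p (normal_density m s z) (normal_density m' s z))
       = gaussian_power_mean \<alpha> p ((m' - m) / s)"
proof -
  have scale: "normal_density k s (m + s * z) = 1 / s * normal_density ((k - m) / s) 1 z" for k z
  proof -
    have "(m + s * z - k)\<^sup>2 / (2 * s\<^sup>2) = (z - (k - m) / s)\<^sup>2 / 2"
      using s by (simp add: field_simps power2_eq_square)
    then show ?thesis
      using s by (simp add: normal_density_def real_sqrt_mult mult_ac)
  qed
  have "power_mean \<alpha> p (normal_density m s (m + s * z)) (normal_density m' s (m + s * z))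
      = 1 / s * power_mean \<alpha> p (normal_density 0 1 z) (normal_density ((m' - m) / s) 1 z)" for z
    unfolding scale using a s by (subst power_mean_scale) (auto simp: normal_density_nonneg)
  then show ?thesis
    using s by (subst lborel_integral_real_affine[of s _ m]) (auto simp: gaussian_power_mean_def)
qed

section \<open>Conditional laws given the label, and the conditional densities of the disclosed
  variable\<close>

context prob_space
begin

text \<open>The noise is independent of the pair (X, C), hence of every event that combines the
  label with a condition on \<open>X\<close>. Dividing the product formula by the probability of the
  label event carries independence over to the conditional measure and leaves the law of
  \<open>N\<close> unchanged.\<close>

lemma indep_var_cond_given_label:
  assumes C: "C \<in> measurable M (count_space {0, 1})"
    and X[measurable]: "X \<in> borel_measurable M" and N[measurable]: "N \<in> borel_measurable M"
    and c: "c \<in> {0, 1}" "measure M (label_event M C c) > 0"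
    and indep: "indep_set (sets (vimage_algebra (space M) N borel))
           (sets (vimage_algebra (space M) (\<lambda>\<omega>. (X \<omega>, C \<omega>)) (borel \<Otimes>\<^sub>M count_space {0, 1})))"
  shows "prob_space.indep_var (cond_given_label M C c) borel X borel (N :: _ \<Rightarrow> real)"
    and "\<And>A. A \<in> sets borel \<Longrightarrow>
      measure (cond_given_label M C c) (N -` A \<inter> space M) = measure M (N -` A \<inter> space M)"
proof -
  note [measurable] = C
  let ?E = "label_event M C c" and ?K = "cond_given_label M C c"
  have E_eq: "?E = C -` {c} \<inter> space M" by (auto simp: label_event_def)
  have E[measurable]: "?E \<in> sets M"
    unfolding E_eq using c by (intro measurable_sets[OF C]) auto
  have E0: "emeasure M ?E \<noteq> 0" "emeasure M ?E \<noteq> \<infinity>"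
    using c by (auto simp: emeasure_eq_measure)
  interpret K: prob_space ?K
    unfolding cond_given_label_def using E0 by (intro prob_space_uniform_measure)
  have [simp]: "space ?K = space M" "sets ?K = sets M"
    by (auto simp: cond_given_label_def)
  have K: "measure ?K B = measure M (?E \<inter> B) / measure M ?E" if "B \<in> sets M" for B
    unfolding cond_given_label_def using E0 that by simp
  have [measurable]: "X \<in> borel_measurable ?K" "N \<in> borel_measurable ?K"
    using X N by (auto simp: measurable_def)
  \<comment> \<open>The event on the label and \<open>X\<close> is the preimage of the rectangle
    \<open>B \<times> {c}\<close> under the pair, so the assumed independence applies to it.\<close>
  have prod: "measure M (?E \<inter> ((X -` B \<inter> space M) \<inter> (N -` A \<inter> space M)))
      = measure M (N -` A \<inter> space M) * measure M (?E \<inter> (X -` B \<inter> space M))"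
    if "A \<in> sets borel" "B \<in> sets borel" for A B
  proof -
    have "N -` A \<inter> space M \<in> sets (vimage_algebra (space M) N borel)"
      using that by (intro in_vimage_algebra)
    moreover have "(\<lambda>\<omega>. (X \<omega>, C \<omega>)) -` (B \<times> {c}) \<inter> space M \<in>
        sets (vimage_algebra (space M) (\<lambda>\<omega>. (X \<omega>, C \<omega>)) (borel \<Otimes>\<^sub>M count_space {0, 1}))"
      using that c by (intro in_vimage_algebra pair_measureI) auto
    ultimately have "measure M ((N -` A \<inter> space M) \<inter> ((\<lambda>\<omega>. (X \<omega>, C \<omega>)) -` (B \<times> {c}) \<inter> space M))
      = measure M (N -` A \<inter> space M) * measure M ((\<lambda>\<omega>. (X \<omega>, C \<omega>)) -` (B \<times> {c}) \<inter> space M)"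
      by (rule indep_setD[OF indep])
    also have "(\<lambda>\<omega>. (X \<omega>, C \<omega>)) -` (B \<times> {c}) \<inter> space M = ?E \<inter> (X -` B \<inter> space M)"
      by (auto simp: E_eq)
    finally have "measure M ((N -` A \<inter> space M) \<inter> (?E \<inter> (X -` B \<inter> space M)))
      = measure M (N -` A \<inter> space M) * measure M (?E \<inter> (X -` B \<inter> space M))" .
    then show ?thesis by (simp add: Int_ac)
  qed
  show N_law: "measure ?K (N -` A \<inter> space M) = measure M (N -` A \<inter> space M)" if "A \<in> sets borel" for A
  proof -
    have "?E \<inter> space M = ?E" by (auto simp: E_eq)
    then show ?thesis
      \<comment> \<open>With \<open>B = UNIV\<close> the condition on \<open>X\<close> is void and
        only the label event remains.\<close>
      using prod[OF that, of UNIV] c that by (simp add: K)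
  qed
  have "K.indep_set (sets (vimage_algebra (space M) X borel)) (sets (vimage_algebra (space M) N borel))"
    unfolding K.indep_sets2_eq
  proof (intro conjI ballI)
    show "sets (vimage_algebra (space M) X borel) \<subseteq> sets ?K" "sets (vimage_algebra (space M) N borel) \<subseteq> sets ?K"
      by (auto simp: sets_vimage_algebra2)
    fix a b assume "a \<in> sets (vimage_algebra (space M) X borel)" "b \<in> sets (vimage_algebra (space M) N borel)"
    then have "a \<in> {X -` A \<inter> space M | A. A \<in> sets borel}" "b \<in> {N -` A \<inter> space M | A. A \<in> sets borel}"
      by (simp_all add: sets_vimage_algebra2)
    then obtain A B where AB: "a = X -` A \<inter> space M" "A \<in> sets borel" "b = N -` B \<inter> space M" "B \<in> sets borel"
      by blast
    then have [measurable]: "a \<in> sets M" "b \<in> sets M" by auto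
    have "measure M (?E \<inter> (a \<inter> b)) = measure M b * measure M (?E \<inter> a)"
      unfolding AB(1,3) by (rule prod[OF AB(4,2)])
    then have "measure ?K (a \<inter> b) = measure M b * measure M (?E \<inter> a) / measure M ?E"
      by (subst K) auto
    also have "\<dots> = measure ?K a * measure ?K b"
      unfolding K[OF \<open>a \<in> sets M\<close>] AB(3) N_law[OF AB(4)] by simp
    finally show "measure ?K (a \<inter> b) = measure ?K a * measure ?K b" .
  qed
  moreover have "X \<in> borel_measurable ?K" "N \<in> borel_measurable ?K" by fact+
  ultimately show "K.indep_var borel X borel N"
    unfolding K.indep_var_eq sets_vimage_algebra \<open>space ?K = space M\<close> by blast
qed

text \<open>Under the conditional measure \<open>X + b\<close> and \<gamma> times \<open>N\<close>
  are independent normal variables, so their sum is normal and the means and variances add.\<close>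

lemma distributed_cond_given_label_add_noise:
  assumes C: "C \<in> measurable M (count_space {0, 1})"
    and X: "X \<in> borel_measurable M" and N: "distributed M lborel N (normal_density 0 1)"
    and c: "c \<in> {0, 1}" "measure M (label_event M C c) > 0"
    and indep: "indep_set (sets (vimage_algebra (space M) N borel))
           (sets (vimage_algebra (space M) (\<lambda>\<omega>. (X \<omega>, C \<omega>)) (borel \<Otimes>\<^sub>M count_space {0, 1})))"
    and X_law: "distributed (cond_given_label M C c) lborel X (normal_density \<mu> \<sigma>)"
    and pos: "\<sigma> > 0" "\<gamma> \<ge> 0"
  shows "distributed (cond_given_label M C c) lborel (\<lambda>\<omega>. X \<omega> + b + \<gamma> * N \<omega>)
    (normal_density (\<mu> + b) (sqrt (\<sigma>\<^sup>2 + \<gamma>\<^sup>2)))"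
proof -
  let ?E = "label_event M C c" and ?K = "cond_given_label M C c"
  have N_meas[measurable]: "N \<in> borel_measurable M"
    using N by (simp add: distributed_def)
  have E0: "emeasure M ?E \<noteq> 0" "emeasure M ?E \<noteq> \<infinity>"
    using c by (auto simp: emeasure_eq_measure)
  interpret K: prob_space ?K
    unfolding cond_given_label_def using E0 by (intro prob_space_uniform_measure)
  have [simp]: "space ?K = space M" "sets ?K = sets M"
    by (auto simp: cond_given_label_def)
  have [measurable]: "X \<in> borel_measurable ?K" "N \<in> borel_measurable ?K"
    using X N_meas by (auto simp: measurable_def)
  note ind = indep_var_cond_given_label[OF C X N_meas c indep]
  have "distr ?K lborel N = distr M lborel N"
  proof (rule measure_eqI)
    fix A assume "A \<in> sets (distr ?K lborel N)"
    then show "emeasure (distr ?K lborel N) A = emeasure (distr M lborel N) A"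
      using ind(2)[of A] by (simp add: emeasure_distr emeasure_eq_measure K.emeasure_eq_measure)
  qed simp
  then have N_law: "distributed ?K lborel N (normal_density 0 1)"
    using N by (simp add: distributed_def)
  have Xb: "distributed ?K lborel (\<lambda>\<omega>. b + 1 * X \<omega>) (normal_density (b + 1 * \<mu>) (\<bar>1\<bar> * \<sigma>))"
    using pos by (intro K.normal_density_affine X_law) auto
  show ?thesis
  \<comment> \<open>For zero \<gamma> the noise term is a point mass without a density, so the sum
    rule for normal variables cannot be applied; the law is then that of the shifted
    \<open>X\<close>.\<close>
  proof (cases "\<gamma> = 0")
    case True
    then show ?thesis using Xb pos by (simp add: add.commute)
  next
    case False
    have \<gamma>N: "distributed ?K lborel (\<lambda>\<omega>. 0 + \<gamma> * N \<omega>) (normal_density (0 + \<gamma> * 0) (\<bar>\<gamma>\<bar> * 1))"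
      using False by (intro K.normal_density_affine N_law) auto
    have "K.indep_var borel ((\<lambda>x. b + 1 * x) \<circ> X) borel ((\<lambda>x. 0 + \<gamma> * x) \<circ> N)"
      by (rule K.indep_var_compose[OF ind(1)]) auto
    then have "K.indep_var borel (\<lambda>\<omega>. b + 1 * X \<omega>) borel (\<lambda>\<omega>. 0 + \<gamma> * N \<omega>)"
      by (simp add: comp_def)
    from K.add_indep_normal[OF this _ _ Xb \<gamma>N]
    show ?thesis using pos False by (simp add: add_ac)
  qed
qed

text \<open>On the label event the shift is a constant, so \<open>disclosed\<close> agrees there
  with \<open>X\<close> plus a constant plus scaled noise. Radon-Nikodym derivatives are unique only
  up to null sets, hence the almost-everywhere form.\<close>

lemma AE_cond_density_disclosed:
  assumes C: "C \<in> measurable M (count_space {0, 1})"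
    and X: "X \<in> borel_measurable M" and N: "distributed M lborel N (normal_density 0 1)"
    and c: "c \<in> {0, 1}" "measure M (label_event M C c) > 0"
    and indep: "indep_set (sets (vimage_algebra (space M) N borel))
           (sets (vimage_algebra (space M) (\<lambda>\<omega>. (X \<omega>, C \<omega>)) (borel \<Otimes>\<^sub>M count_space {0, 1})))"
    and X_law: "distributed (cond_given_label M C c) lborel X (normal_density \<mu> \<sigma>)"
    and pos: "\<sigma> > 0" "\<gamma> \<ge> 0"
  shows "AE z in lborel. cond_density M C (disclosed C X N \<beta>\<^sub>0 \<beta>\<^sub>1 \<gamma>) c z
    = normal_density (\<mu> + ((1 - real c) * \<beta>\<^sub>0 - real c * \<beta>\<^sub>1)) (sqrt (\<sigma>\<^sup>2 + \<gamma>\<^sup>2)) z"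
proof -
  let ?E = "label_event M C c" and ?K = "cond_given_label M C c"
  let ?b = "(1 - real c) * \<beta>\<^sub>0 - real c * \<beta>\<^sub>1"
  let ?Z = "disclosed C X N \<beta>\<^sub>0 \<beta>\<^sub>1 \<gamma>"
  let ?f = "normal_density (\<mu> + ?b) (sqrt (\<sigma>\<^sup>2 + \<gamma>\<^sup>2))"
  have law: "distributed ?K lborel (\<lambda>\<omega>. X \<omega> + ?b + \<gamma> * N \<omega>) ?f"
    by (rule distributed_cond_given_label_add_noise) fact+
  have [measurable]: "N \<in> borel_measurable M" "X \<in> borel_measurable M"
    using N X by (auto simp: distributed_def)
  have [measurable]: "(\<lambda>\<omega>. real (C \<omega>)) \<in> borel_measurable M"
    by (rule measurable_compose[OF C]) simp
  have sets_K: "sets ?K = sets M"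
    by (auto simp: cond_given_label_def)
  have E: "?E \<in> sets M"
    using measurable_sets[OF C, of "{c}"] c by (simp add: label_event_def vimage_def Int_def conj_commute)
  have "?Z \<in> borel_measurable M"
    unfolding disclosed_def by measurable
  then have Z: "?Z \<in> measurable ?K lborel"
    using sets_K by (simp cong: measurable_cong_sets)
  \<comment> \<open>The conditional measure is concentrated on the label event, where
    \<open>C \<omega> = c\<close>.\<close>
  have "AE \<omega> in ?K. ?Z \<omega> = X \<omega> + ?b + \<gamma> * N \<omega>"
    unfolding cond_given_label_def
    by (rule AE_uniform_measureI[OF E]) (auto simp: label_event_def disclosed_def)
  then have "distr ?K lborel ?Z = distr ?K lborel (\<lambda>\<omega>. X \<omega> + ?b + \<gamma> * N \<omega>)"
    using Z law by (intro distr_cong_AE) (auto simp: distributed_def)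
  also have "\<dots> = density lborel ?f"
    using law by (simp add: distributed_def)
  finally have "AE z in lborel. ennreal (?f z) = RN_deriv lborel (distr ?K lborel ?Z) z"
    by (intro sigma_finite_measure.RN_deriv_unique sigma_finite_lborel) auto
  then show ?thesis
    unfolding cond_density_def by eventually_elim (metis enn2real_ennreal normal_density_nonneg)
qed

end

section \<open>Passing from one objective to the other: minimizers depend only on the strict order
  among feasible points\<close>

lemma is_arg_min_strict_mono_iff:
  fixes f :: "'a \<Rightarrow> 'b::linorder" and g :: "'a \<Rightarrow> 'c::linorder"
  assumes "\<And>x y. P x \<Longrightarrow> P y \<Longrightarrow> f x < f y \<longleftrightarrow> g x < g y"
  shows "is_arg_min f P x \<longleftrightarrow> is_arg_min g P x"
  using assms by (auto simp: is_arg_min_def)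

theorem mainTheorem6:
  fixes M :: "'a measure" and C :: "'a \<Rightarrow> nat" and X N :: "'a \<Rightarrow> real"
    and \<mu>\<^sub>0 \<mu>\<^sub>1 \<sigma> p D \<alpha> :: real
  assumes "\<mu>\<^sub>0 \<le> \<mu>\<^sub>1" and "\<sigma> > 0" and "0 < p" and "p < 1" and "D \<ge> 0" and "\<alpha> > 1"
    and "prob_space M"
    and "C \<in> measurable M (count_space {0, 1})"
    and "measure M (label_event M C 0) = p"
    and "measure M (label_event M C 1) = 1 - p"
    and "X \<in> borel_measurable M"
    and "distributed (cond_given_label M C 0) lborel X (normal_density \<mu>\<^sub>0 \<sigma>)"
    and "distributed (cond_given_label M C 1) lborel X (normal_density \<mu>\<^sub>1 \<sigma>)"
    and "distributed M lborel N (normal_density 0 1)"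
    and "prob_space.indep_set M
           (sets (vimage_algebra (space M) N borel))
           (sets (vimage_algebra (space M) (\<lambda>\<omega>. (X \<omega>, C \<omega>))
                   (borel \<Otimes>\<^sub>M count_space {0, 1})))"
  shows "{b. is_arg_min (\<lambda>(\<beta>\<^sub>0, \<beta>\<^sub>1, \<gamma>). sibson_mi \<alpha> M C (disclosed C X N \<beta>\<^sub>0 \<beta>\<^sub>1 \<gamma>))
              (\<lambda>b. b \<in> feasible \<mu>\<^sub>0 \<mu>\<^sub>1 p D) b} =
         {b. is_arg_min (\<lambda>(\<beta>\<^sub>0, \<beta>\<^sub>1, \<gamma>).
                ((\<mu>\<^sub>1 - \<beta>\<^sub>1) - (\<mu>\<^sub>0 + \<beta>\<^sub>0)) / sqrt (\<sigma>\<^sup>2 + \<gamma>\<^sup>2))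
              (\<lambda>b. b \<in> feasible \<mu>\<^sub>0 \<mu>\<^sub>1 p D) b}"
proof -
  interpret prob_space M by fact
  let ?\<rho> = "\<lambda>(\<beta>\<^sub>0, \<beta>\<^sub>1, \<gamma>). ((\<mu>\<^sub>1 - \<beta>\<^sub>1) - (\<mu>\<^sub>0 + \<beta>\<^sub>0)) / sqrt (\<sigma>\<^sup>2 + \<gamma>\<^sup>2)"
  let ?I = "\<lambda>(\<beta>\<^sub>0, \<beta>\<^sub>1, \<gamma>). sibson_mi \<alpha> M C (disclosed C X N \<beta>\<^sub>0 \<beta>\<^sub>1 \<gamma>)"
  \<comment> \<open>The constraint on the shifted means keeps the separation in the half-line on
    which \<open>gaussian_power_mean\<close> was shown to increase.\<close>
  have \<rho>_nonneg: "?\<rho> b \<ge> 0" if "b \<in> feasible \<mu>\<^sub>0 \<mu>\<^sub>1 p D" for b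
    using that by (auto simp: feasible_def)
  have I_eq: "?I b = \<alpha> / (\<alpha> - 1) * ln (gaussian_power_mean \<alpha> p (?\<rho> b))"
    if feas: "b \<in> feasible \<mu>\<^sub>0 \<mu>\<^sub>1 p D" for b
  proof -
    obtain \<beta>\<^sub>0 \<beta>\<^sub>1 \<gamma> where b: "b = (\<beta>\<^sub>0, \<beta>\<^sub>1, \<gamma>)" and \<gamma>: "\<gamma> \<ge> 0"
      using feas by (cases b) (auto simp: feasible_def)
    let ?s = "sqrt (\<sigma>\<^sup>2 + \<gamma>\<^sup>2)"
    let ?Z = "disclosed C X N \<beta>\<^sub>0 \<beta>\<^sub>1 \<gamma>"
    have s: "?s > 0" using assms(2) by (simp add: add_pos_nonneg)
    have d0: "AE z in lborel. cond_density M C ?Z 0 z = normal_density (\<mu>\<^sub>0 + \<beta>\<^sub>0) ?s z"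
      using AE_cond_density_disclosed[OF assms(8) assms(11) assms(14) _ _ assms(15) assms(12) assms(2) \<gamma>, of \<beta>\<^sub>0 \<beta>\<^sub>1]
        assms(3,9) by simp
    have d1: "AE z in lborel. cond_density M C ?Z 1 z = normal_density (\<mu>\<^sub>1 - \<beta>\<^sub>1) ?s z"
      using AE_cond_density_disclosed[OF assms(8) assms(11) assms(14) _ _ assms(15) assms(13) assms(2) \<gamma>, of \<beta>\<^sub>0 \<beta>\<^sub>1]
        assms(4,10) by simp
    have [measurable]: "(\<lambda>z. cond_density M C ?Z c z) \<in> borel_measurable borel" for c
      unfolding cond_density_def by measurable
    \<comment> \<open>The densities are known only almost everywhere, which suffices under the
      integral.\<close>
    have "(LINT z|lborel. power_mean \<alpha> p (cond_density M C ?Z 0 z) (cond_density M C ?Z 1 z))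
        = (LINT z|lborel. power_mean \<alpha> p (normal_density (\<mu>\<^sub>0 + \<beta>\<^sub>0) ?s z) (normal_density (\<mu>\<^sub>1 - \<beta>\<^sub>1) ?s z))"
      using d0 d1 by (intro integral_cong_AE) auto
    also have "\<dots> = gaussian_power_mean \<alpha> p (?\<rho> b)"
      using integral_power_mean_normal_density[OF assms(6,3,4) s] by (simp add: b)
    finally show ?thesis
      using assms(9,10) by (simp add: b sibson_mi_def power_mean_def)
  qed
  have "?I x < ?I y \<longleftrightarrow> ?\<rho> x < ?\<rho> y"
    if x: "x \<in> feasible \<mu>\<^sub>0 \<mu>\<^sub>1 p D" and y: "y \<in> feasible \<mu>\<^sub>0 \<mu>\<^sub>1 p D" for x y
  proof -
    let ?G = "gaussian_power_mean \<alpha> p"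
    \<comment> \<open>The prefactor \<open>\<alpha> / (\<alpha> - 1)\<close> is positive because
      \<alpha> > 1, so it preserves the order.\<close>
    have "?I x < ?I y \<longleftrightarrow> ln (?G (?\<rho> x)) < ln (?G (?\<rho> y))"
      unfolding I_eq[OF x] I_eq[OF y] using assms(6) by (intro mult_less_cancel_left_pos) simp
    also have "\<dots> \<longleftrightarrow> ?G (?\<rho> x) < ?G (?\<rho> y)"
      by (intro ln_less_cancel_iff gaussian_power_mean_pos[OF assms(6,3,4)] \<rho>_nonneg x y)
    also have "\<dots> \<longleftrightarrow> ?\<rho> x < ?\<rho> y"
      by (rule strict_mono_on_less[of "{0..}"])
        (use gaussian_power_mean_strict_mono[OF assms(6,3,4)] \<rho>_nonneg[OF x] \<rho>_nonneg[OF y]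
          in \<open>auto simp: strict_mono_on_def\<close>)
    finally show ?thesis .
  qed
  then show ?thesis
    by (intro Collect_cong is_arg_min_strict_mono_iff)
qed

end
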